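(* Let $F_2=F(a,b)$ be the free group with free basis $\{a,b\}$. Let $n,t\ge 1$ be integers and let $d,d'\ge 2$ be integers such that $d\nmid n$ and $d'\nmid t$, and such that $d\le n$, $d'\le t$. Then $$d_{simp}(a^n b^t; F_2)\le d_{prim}(a^n b^t; F_2)\le d+d'-2.$$
   Context: A nontrivial element $g$ of a free group $U$ is called primitive in $U$ if $g$ belongs to some free basis of $U$. A nontrivial element $g$ of a nonabelian free group $U$ is called simple in $U$ if it belongs to a proper free factor of $U$, i.e. there is a free product decomposition $U=U_1\ast U_2$ with $U_1\ne 1$, $U_2\ne 1$ and $g\in U_1$. For $1\ne g\in F_2$, the primitivity index $d_{prim}(g;F_2)$ (respectively, the simplicity index $d_{simp}(g;F_2)$) is the smallest index $[F_2:H]$ of a finite-index subgroup $H\le F_2$ such that $g\in H$ and $g$ is primitive (respectively, simple) in $H$ (such $H$ always exists). *)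

theory Defs
  imports "HOL-Algebra.Generated_Groups" "HOL-Algebra.Coset" "HOL-Library.Extended_Nat"
begin

text \<open>A word over \<open>S\<close> is a list of letters \<open>(x, e)\<close> with \<open>x \<in> S\<close>; the letter stands for \<open>x\<close>
  if \<open>e\<close> holds and for the inverse of \<open>x\<close> otherwise.\<close>

definition letter_value :: "('a, 'b) monoid_scheme \<Rightarrow> 'a \<times> bool \<Rightarrow> 'a" where
  "letter_value G l = (if snd l then fst l else inv\<^bsub>G\<^esub> fst l)"

definition word_value :: "('a, 'b) monoid_scheme \<Rightarrow> ('a \<times> bool) list \<Rightarrow> 'a" where
  "word_value G w = foldr (\<lambda>l y. letter_value G l \<otimes>\<^bsub>G\<^esub> y) w \<one>\<^bsub>G\<^esub>"

definition reduced_word :: "('a \<times> bool) list \<Rightarrow> bool" where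
  "reduced_word w \<longleftrightarrow> successively (\<lambda>l m. fst l = fst m \<longrightarrow> snd l = snd m) w"

text \<open>The universal property quantifies over groups of all types and is not available as a
  definition in HOL, so freeness is expressed by the absence of nontrivial reduced relations.\<close>

definition free_basis :: "('a, 'b) monoid_scheme \<Rightarrow> 'a set \<Rightarrow> bool" where
  "free_basis G S \<longleftrightarrow>
     S \<subseteq> carrier G \<and> generate G S = carrier G \<and>
     (\<forall>w. set w \<subseteq> S \<times> UNIV \<longrightarrow> reduced_word w \<longrightarrow> w \<noteq> [] \<longrightarrow> word_value G w \<noteq> \<one>\<^bsub>G\<^esub>)"

definition free_group :: "('a, 'b) monoid_scheme \<Rightarrow> bool" where
  "free_group G \<longleftrightarrow> group G \<and> (\<exists>S. free_basis G S)"

definition primitive_in :: "('a, 'b) monoid_scheme \<Rightarrow> 'a \<Rightarrow> bool" where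
  "primitive_in U g \<longleftrightarrow>
     free_group U \<and> g \<in> carrier U \<and> g \<noteq> \<one>\<^bsub>U\<^esub> \<and> (\<exists>S. free_basis U S \<and> g \<in> S)"

text \<open>\<open>G\<close> is the internal free product of its subgroups \<open>A\<close> and \<open>B\<close>. The normal form condition
  also forces \<open>A \<inter> B\<close> to be trivial: for \<open>x \<in> A \<inter> B\<close> with \<open>x \<noteq> \<one>\<close>, the list \<open>[x, inv x]\<close>
  counts as alternating and has product \<open>\<one>\<close>.\<close>

definition internal_free_product :: "('a, 'b) monoid_scheme \<Rightarrow> 'a set \<Rightarrow> 'a set \<Rightarrow> bool" where
  "internal_free_product G A B \<longleftrightarrow>
     subgroup A G \<and> subgroup B G \<and> generate G (A \<union> B) = carrier G \<and>
     (\<forall>w. set w \<subseteq> (A \<union> B) - {\<one>\<^bsub>G\<^esub>} \<longrightarrow>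
          successively (\<lambda>x y. x \<in> A \<and> y \<in> B \<or> x \<in> B \<and> y \<in> A) w \<longrightarrow>
          w \<noteq> [] \<longrightarrow> foldr (\<lambda>x y. x \<otimes>\<^bsub>G\<^esub> y) w \<one>\<^bsub>G\<^esub> \<noteq> \<one>\<^bsub>G\<^esub>)"

definition simple_in :: "('a, 'b) monoid_scheme \<Rightarrow> 'a \<Rightarrow> bool" where
  "simple_in U g \<longleftrightarrow>
     free_group U \<and> \<not> comm_group U \<and> g \<in> carrier U \<and> g \<noteq> \<one>\<^bsub>U\<^esub> \<and>
     (\<exists>A B. internal_free_product U A B \<and> A \<noteq> {\<one>\<^bsub>U\<^esub>} \<and> B \<noteq> {\<one>\<^bsub>U\<^esub>} \<and> g \<in> A)"

definition finite_index_subgroup :: "('a, 'b) monoid_scheme \<Rightarrow> 'a set \<Rightarrow> bool" where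
  "finite_index_subgroup F H \<longleftrightarrow> subgroup H F \<and> finite (rcosets\<^bsub>F\<^esub> H)"

text \<open>The minima are taken in \<open>enat\<close>, where every nonempty set contains its infimum and the
  infimum of the empty set is \<open>\<infinity>\<close>. A finite value thus means that a suitable subgroup exists.\<close>

definition d_prim :: "'a \<Rightarrow> ('a, 'b) monoid_scheme \<Rightarrow> enat" where
  "d_prim g F =
     Inf {enat (card (rcosets\<^bsub>F\<^esub> H)) | H.
            finite_index_subgroup F H \<and> g \<in> H \<and> primitive_in (F\<lparr>carrier := H\<rparr>) g}"

definition d_simp :: "'a \<Rightarrow> ('a, 'b) monoid_scheme \<Rightarrow> enat" where
  "d_simp g F =
     Inf {enat (card (rcosets\<^bsub>F\<^esub> H)) | H.
            finite_index_subgroup F H \<and> g \<in> H \<and> simple_in (F\<lparr>carrier := H\<rparr>) g}"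

end

theory Submission
  imports Defs "HOL-Algebra.Bij"
begin

text \<open>Glue a cycle of \<open>d\<close> edges labelled \<open>a\<close> and a cycle of \<open>d'\<close> edges labelled \<open>b\<close> along two
  vertices, the base point and the end point of the path \<open>b\<^sup>t\<close>, placed so that \<open>a\<^sup>n\<close> leads back to the base
  point; this is possible because \<open>d\<close> does not divide \<open>n\<close> and \<open>d'\<close> does not divide \<open>t\<close>. Adding a loop
  with the missing label at each other vertex gives a covering of the rose with \<open>d + d' - 2\<close> vertices,
  whose fundamental group \<open>H\<close> is generated by \<open>a\<^sup>d\<close>, \<open>b\<^sup>d'\<close>, \<open>g = a\<^sup>n b\<^sup>t\<close> and conjugates coming from the loops.
  To see that these generators are free, let \<open>F\<close> act on pairs of a vertex and a reduced word over them, in such a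
  way that each generator fixes the base point and multiplies the word by itself. Finally, a
  basis element \<open>g\<close> of a noncommutative free group with basis \<open>S\<close> lies in the free factor generated by \<open>g\<close>,
  with complement generated by \<open>S - {g}\<close>, so primitive elements are simple.\<close>

section \<open>Words and the universal property\<close>

lemma word_value_Nil [simp]: "word_value G [] = \<one>\<^bsub>G\<^esub>"
  by (simp add: word_value_def)

lemma word_value_Cons [simp]: "word_value G (l # w) = letter_value G l \<otimes>\<^bsub>G\<^esub> word_value G w"
  by (simp add: word_value_def)

definition inv_word :: "('a \<times> bool) list \<Rightarrow> ('a \<times> bool) list" where
  "inv_word w = map (apsnd Not) (rev w)"

lemma fst_image_inv_word: "fst ` set (inv_word w) = fst ` set w"
  by (force simp: inv_word_def image_image)

lemma subset_Times_UNIV_iff: "A \<subseteq> S \<times> UNIV \<longleftrightarrow> fst ` A \<subseteq> S"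
  by force

lemma not_reduced_word_split:
  assumes "\<not> reduced_word w"
  obtains u x e v where "w = u @ (x, e) # (x, \<not> e) # v"
  using assms
proof (induction w arbitrary: thesis)
  case Nil
  then show ?case by (simp add: reduced_word_def)
next
  case (Cons l w)
  show ?case
  proof (cases "reduced_word w")
    case True
    with Cons.prems(2) have "w \<noteq> []" "fst l = fst (hd w)" "snd l \<noteq> snd (hd w)"
      by (auto simp: reduced_word_def successively_Cons)
    then have "l # w = [] @ (fst l, snd l) # (fst l, \<not> snd l) # tl w"
      by (cases w; cases l; cases "hd w") auto
    then show ?thesis by (rule Cons.prems(1))
  next
    case False
    obtain u x e v where "w = u @ (x, e) # (x, \<not> e) # v"
      by (rule Cons.IH[OF _ False])
    then have "l # w = (l # u) @ (x, e) # (x, \<not> e) # v" by simp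
    then show ?thesis by (rule Cons.prems(1))
  qed
qed

context group
begin

lemma letter_value_closed [simp]: "fst l \<in> carrier G \<Longrightarrow> letter_value G l \<in> carrier G"
  by (simp add: letter_value_def)

lemma word_value_closed [simp]: "fst ` set w \<subseteq> carrier G \<Longrightarrow> word_value G w \<in> carrier G"
  by (induction w) auto

lemma word_value_append:
  "fst ` set u \<subseteq> carrier G \<Longrightarrow> fst ` set v \<subseteq> carrier G \<Longrightarrow>
     word_value G (u @ v) = word_value G u \<otimes> word_value G v"
  by (induction u) (auto simp: m_assoc)

lemma word_value_inv_word:
  "fst ` set w \<subseteq> carrier G \<Longrightarrow> word_value G (inv_word w) = inv (word_value G w)"
proof (induction w)
  case Nil
  then show ?case by (simp add: inv_word_def)
next
  case (Cons l w)
  have "fst ` set (inv_word w) \<subseteq> carrier G"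
    using Cons.prems by (simp add: fst_image_inv_word)
  moreover have "letter_value G (apsnd Not l) = inv (letter_value G l)"
    using Cons.prems by (auto simp: letter_value_def)
  moreover have "inv_word (l # w) = inv_word w @ [apsnd Not l]"
    by (simp add: inv_word_def)
  ultimately show ?case
    using Cons by (simp add: word_value_append inv_mult_group)
qed

lemma word_value_cancel:
  assumes "fst ` set (u @ (x, e) # (x, \<not> e) # v) \<subseteq> carrier G"
  shows "word_value G (u @ (x, e) # (x, \<not> e) # v) = word_value G (u @ v)"
proof -
  have "letter_value G (x, e) \<otimes> (letter_value G (x, \<not> e) \<otimes> word_value G v) = word_value G v"
    using assms by (cases e) (simp_all add: letter_value_def image_Un flip: m_assoc)
  then show ?thesis
    using assms by (simp add: word_value_append image_Un)
qed

lemma generate_eq_word_values: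
  assumes "S \<subseteq> carrier G"
  shows "generate G S = word_value G ` {w. fst ` set w \<subseteq> S}"
proof (intro equalityI subsetI)
  fix x assume "x \<in> generate G S"
  then show "x \<in> word_value G ` {w. fst ` set w \<subseteq> S}"
  proof induction
    case one
    show ?case by (rule image_eqI[of _ _ "[]"]) auto
  next
    case (incl h)
    then show ?case using assms
      by (intro image_eqI[of _ _ "[(h, True)]"]) (auto simp: letter_value_def)
  next
    case (inv h)
    then show ?case using assms
      by (intro image_eqI[of _ _ "[(h, False)]"]) (auto simp: letter_value_def)
  next
    case (eng h1 h2)
    then obtain w1 w2 where "h1 = word_value G w1" "fst ` set w1 \<subseteq> S"
      "h2 = word_value G w2" "fst ` set w2 \<subseteq> S"
      by blast
    with assms show ?case
      by (intro image_eqI[of _ _ "w1 @ w2"]) (auto simp: word_value_append)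
  qed
next
  fix x assume "x \<in> word_value G ` {w. fst ` set w \<subseteq> S}"
  then obtain w where "fst ` set w \<subseteq> S" "x = word_value G w" by blast
  then show "x \<in> generate G S"
  proof (induction w arbitrary: x)
    case Nil
    then show ?case by (simp add: generate.one)
  next
    case (Cons l w)
    then show ?case
      by (auto simp: letter_value_def intro: generate.eng generate.incl generate.inv)
  qed
qed

text \<open>A shortest word for \<open>x\<close> is reduced, since cancelling an adjacent inverse
  pair would give a shorter one.\<close>

lemma ex_reduced_word:
  assumes "S \<subseteq> carrier G" and "x \<in> generate G S"
  obtains w where "fst ` set w \<subseteq> S" "reduced_word w" "word_value G w = x"
proof -
  let ?W = "\<lambda>w. fst ` set w \<subseteq> S \<and> word_value G w = x"
  obtain w0 where "?W w0"
    using assms by (auto simp: generate_eq_word_values)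
  then obtain w where w: "?W w" and min: "\<And>u. ?W u \<Longrightarrow> length w \<le> length u"
    using ex_has_least_nat[of ?W w0 length] by blast
  have "reduced_word w"
  proof (rule ccontr)
    assume "\<not> reduced_word w"
    then obtain u y e v where eq: "w = u @ (y, e) # (y, \<not> e) # v"
      by (rule not_reduced_word_split)
    have "?W (u @ v)"
      using w assms(1) word_value_cancel[of u y e v] by (simp add: eq image_Un subset_trans[of _ S] subsetD)
    then show False
      using min[of "u @ v"] by (simp add: eq)
  qed
  with w show thesis by (intro that[of w]) simp_all
qed

section \<open>Extending maps on a free basis to homomorphisms\<close>

lemma free_basis_relation:
  assumes "free_basis G S" and "group K" and "f \<in> S \<rightarrow> carrier K"
    and "fst ` set w \<subseteq> S" and "word_value G w = \<one>"
  shows "word_value K (map (apfst f) w) = \<one>\<^bsub>K\<^esub>"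
  using assms(4,5)
proof (induction w rule: length_induct)
  case (1 w)
  interpret K: group K by fact
  show ?case
  proof (cases "w = []")
    case False
    \<comment> \<open>Freeness excludes nonempty reduced relations, so \<open>w\<close> has a
      cancelling pair; deleting it keeps both values and shortens the word.\<close>
    with 1 assms(1) have "\<not> reduced_word w"
      by (auto simp: free_basis_def subset_Times_UNIV_iff)
    then obtain u x e v where eq: "w = u @ (x, e) # (x, \<not> e) # v"
      by (rule not_reduced_word_split)
    have sub: "fst ` set w \<subseteq> carrier G"
      using 1(2) assms(1) by (auto simp: free_basis_def)
    then have "word_value G (u @ v) = \<one>"
      using 1(3) word_value_cancel[of u x e v] by (simp add: eq)
    moreover have "length (u @ v) < length w" "fst ` set (u @ v) \<subseteq> S"
      using 1(2) by (auto simp: eq)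
    ultimately have "word_value K (map (apfst f) (u @ v)) = \<one>\<^bsub>K\<^esub>"
      using 1(1) by blast
    moreover have "fst ` set (map (apfst f) w) \<subseteq> carrier K"
      using 1(2) assms(3) by force
    ultimately show ?thesis
      using K.word_value_cancel[of "map (apfst f) u" "f x" e "map (apfst f) v"] by (simp add: eq)
  qed simp
qed

text \<open>Choose a word over \<open>S\<close> for each element and evaluate its image in
  \<open>K\<close>. Two words of equal value give the relation \<open>u @ inv_word w\<close>, which
  persists in \<open>K\<close>, so the choice does not matter.\<close>

lemma free_basis_hom_exists:
  assumes "free_basis G S" and "group K" and "f \<in> S \<rightarrow> carrier K"
  obtains h where "h \<in> hom G K" "\<And>s. s \<in> S \<Longrightarrow> h s = f s"
proof -
  interpret K: group K by fact
  let ?v = "\<lambda>w. word_value K (map (apfst f) w)"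
  have S: "S \<subseteq> carrier G" and gen: "carrier G = word_value G ` {w. fst ` set w \<subseteq> S}"
    using assms(1) by (auto simp: free_basis_def generate_eq_word_values[symmetric])
  have cl: "fst ` set (map (apfst f) w) \<subseteq> carrier K" if "fst ` set w \<subseteq> S" for w
    using that assms(3) by force
  have wd: "?v u = ?v w"
    if "fst ` set u \<subseteq> S" "fst ` set w \<subseteq> S" "word_value G u = word_value G w" for u w
  proof -
    have sub: "fst ` set u \<subseteq> carrier G" "fst ` set w \<subseteq> carrier G"
      using that S by auto
    then have "word_value G (u @ inv_word w) = \<one>"
      using that by (simp add: word_value_append fst_image_inv_word word_value_inv_word)
    then have "?v (u @ inv_word w) = \<one>\<^bsub>K\<^esub>"
      by (intro free_basis_relation[OF assms])
        (use that in \<open>auto simp: image_Un fst_image_inv_word\<close>)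
    moreover have "map (apfst f) (inv_word w) = inv_word (map (apfst f) w)"
      by (simp add: inv_word_def rev_map)
    ultimately have "?v u \<otimes>\<^bsub>K\<^esub> inv\<^bsub>K\<^esub> ?v w = \<one>\<^bsub>K\<^esub>"
      using cl[OF that(1)] cl[OF that(2)]
      by (simp only: map_append K.word_value_append fst_image_inv_word K.word_value_inv_word)
    moreover have "?v u \<in> carrier K" "?v w \<in> carrier K"
      using cl[OF that(1)] cl[OF that(2)] by (auto simp del: set_map)
    ultimately show ?thesis by (metis K.inv_closed K.inv_inv K.inv_equality)
  qed
  define c where "c x = (SOME w. fst ` set w \<subseteq> S \<and> word_value G w = x)" for x
  have c: "fst ` set (c x) \<subseteq> S" "word_value G (c x) = x" if "x \<in> carrier G" for x
  proof -
    have "\<exists>w. fst ` set w \<subseteq> S \<and> word_value G w = x"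
      using that gen by auto
    then show "fst ` set (c x) \<subseteq> S" "word_value G (c x) = x"
      unfolding c_def by (metis (mono_tags, lifting) someI_ex)+
  qed
  show thesis
  proof (rule that[of "\<lambda>x. ?v (c x)"])
    show "(\<lambda>x. ?v (c x)) \<in> hom G K"
    proof (rule homI)
      fix x assume "x \<in> carrier G"
      then show "?v (c x) \<in> carrier K"
        using cl[OF c(1)] by (simp del: set_map)
    next
      fix x y assume xy: "x \<in> carrier G" "y \<in> carrier G"
      have "fst ` set (c x) \<subseteq> carrier G" "fst ` set (c y) \<subseteq> carrier G"
        using c(1) xy S by blast+
      then have "word_value G (c x @ c y) = x \<otimes> y"
        using c(2) xy by (simp add: word_value_append)
      moreover have "fst ` set (c x @ c y) \<subseteq> S"
        using c(1) xy by (simp add: image_Un)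
      ultimately have "?v (c (x \<otimes> y)) = ?v (c x @ c y)"
        using xy c[of "x \<otimes> y"] by (intro wd) auto
      then show "?v (c (x \<otimes> y)) = ?v (c x) \<otimes>\<^bsub>K\<^esub> ?v (c y)"
        using cl[OF c(1)[OF xy(1)]] cl[OF c(1)[OF xy(2)]]
        by (simp only: map_append K.word_value_append)
    qed
  next
    fix s assume s: "s \<in> S"
    then have "?v (c s) = ?v [(s, True)]"
      using c[of s] S by (intro wd) (auto simp: letter_value_def)
    then show "?v (c s) = f s"
      using s funcset_mem[OF assms(3)] by (simp add: letter_value_def)
  qed
qed

end

section \<open>Detecting freeness by an action on reduced words\<close>

lemma carrier_BijGroup_UNIV: "carrier (BijGroup UNIV) = {f. bij f}"
  by (simp add: BijGroup_def Bij_def)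

lemma one_BijGroup_UNIV: "\<one>\<^bsub>BijGroup UNIV\<^esub> = id"
  by (simp add: BijGroup_def restrict_def id_def)

lemma mult_BijGroup_UNIV: "bij f \<Longrightarrow> bij g \<Longrightarrow> f \<otimes>\<^bsub>BijGroup UNIV\<^esub> g = f \<circ> g"
  by (simp add: BijGroup_def Bij_def compose_def restrict_def comp_def)

lemma inv_BijGroup_UNIV: "bij f \<Longrightarrow> inv\<^bsub>BijGroup UNIV\<^esub> f = Hilbert_Choice.inv f"
  by (simp add: inv_BijGroup Bij_def restrict_def)

context group
begin

context
  fixes h :: "'a \<Rightarrow> 'y \<Rightarrow> 'y"
  assumes h: "h \<in> hom G (BijGroup UNIV)"
begin

interpretation h: group_hom G "BijGroup UNIV" h
  by (intro group_hom.intro group_hom_axioms.intro is_group group_BijGroup h)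

lemma action_bij: "x \<in> carrier G \<Longrightarrow> bij (h x)"
  using h.hom_closed by (simp add: carrier_BijGroup_UNIV)

lemma action_one: "h \<one> = id"
  by (simp add: one_BijGroup_UNIV)

lemma action_mult:
  "x \<in> carrier G \<Longrightarrow> y \<in> carrier G \<Longrightarrow> h (x \<otimes> y) = h x \<circ> h y"
  by (simp add: mult_BijGroup_UNIV action_bij)

lemma action_inv: "x \<in> carrier G \<Longrightarrow> h (inv x) = Hilbert_Choice.inv (h x)"
  by (simp add: inv_BijGroup_UNIV action_bij)

lemma action_inv_eq: "x \<in> carrier G \<Longrightarrow> h x y = z \<Longrightarrow> h (inv x) z = y"
  by (simp only: action_inv action_bij flip: bij_inv_eq_iff)

lemma action_pow: "x \<in> carrier G \<Longrightarrow> h (x [^] (n::nat)) = h x ^^ n"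
proof (induction n)
  case 0
  then show ?case by (simp only: nat_pow_0 action_one funpow_0 funpow.simps id_def)
next
  case (Suc n)
  then show ?case
    by (simp only: nat_pow_Suc action_mult nat_pow_closed funpow_Suc_right)
qed

end

end

text \<open>Left multiplication by a letter with free reduction. Unreduced lists are fixed so that
  the map permutes the whole list type, as \<open>BijGroup UNIV\<close> requires.\<close>

definition prepend :: "'a \<times> bool \<Rightarrow> ('a \<times> bool) list \<Rightarrow> ('a \<times> bool) list" where
  "prepend l w =
     (if \<not> reduced_word w then w
      else if w \<noteq> [] \<and> hd w = apsnd Not l then tl w
      else l # w)"

lemma prepend_cancel: "prepend (apsnd Not l) (prepend l w) = w"
proof (cases "reduced_word w")
  case red: True
  show ?thesis
  proof (cases "w \<noteq> [] \<and> hd w = apsnd Not l")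
    case True
    then obtain u where w: "w = apsnd Not l # u"
      by (cases w) auto
    have "reduced_word u" "u = [] \<or> hd u \<noteq> l"
      using red by (cases l; auto simp: w reduced_word_def successively_Cons)+
    then show ?thesis
      using red by (cases l) (auto simp: w prepend_def)
  next
    case False
    then have "w = [] \<or> (fst l = fst (hd w) \<longrightarrow> snd l = snd (hd w))"
      by (cases l; cases "hd w") auto
    then have "reduced_word (l # w)"
      using red by (auto simp: reduced_word_def successively_Cons)
    then have "prepend (apsnd Not l) (l # w) = w"
      by (cases l) (simp add: prepend_def)
    moreover have "prepend l w = l # w"
      using red False by (simp only: prepend_def if_False if_True simp_thms)
    ultimately show ?thesis by simp
  qed
qed (simp add: prepend_def)

lemma bij_prepend: "bij (prepend l)"
proof (rule o_bij)
  show "prepend (apsnd Not l) \<circ> prepend l = id"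
    by (simp add: fun_eq_iff prepend_cancel)
  show "prepend l \<circ> prepend (apsnd Not l) = id"
    using prepend_cancel[of "apsnd Not l"] by (cases l) (simp add: fun_eq_iff)
qed

lemma prepend_reduced:
  assumes "reduced_word (l # w)"
  shows "prepend l w = l # w"
proof -
  have "reduced_word w" and "w = [] \<or> (fst l = fst (hd w) \<longrightarrow> snd l = snd (hd w))"
    using assms by (auto simp: reduced_word_def successively_Cons)
  moreover from this(2) have "\<not> (w \<noteq> [] \<and> hd w = apsnd Not l)"
    by (metis fst_apsnd snd_apsnd)
  ultimately show ?thesis
    by (simp only: prepend_def if_False if_True simp_thms)
qed

context group
begin

text \<open>A reduced word spells itself out in the fibre over \<open>v\<close>, because no
  \<open>prepend\<close> along it cancels. Distinct reduced words therefore have distinct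
  values.\<close>

lemma action_word_value:
  assumes "h \<in> hom G (BijGroup UNIV)" and "S \<subseteq> carrier G"
    and S: "\<And>s x. s \<in> S \<Longrightarrow> h s (v, x) = (v, prepend (s, True) x)"
    and "fst ` set w \<subseteq> S" and "reduced_word w"
  shows "h (word_value G w) (v, []) = (v, w)"
  using assms(4,5)
proof (induction w)
  case Nil
  then show ?case by (simp add: action_one[OF assms(1)])
next
  case (Cons l w)
  have w: "reduced_word w" "fst ` set w \<subseteq> carrier G" and l: "fst l \<in> S" "fst l \<in> carrier G"
    using Cons.prems assms(2) by (auto simp: reduced_word_def successively_Cons)
  have inv: "h (inv s) (v, x) = (v, prepend (s, False) x)" if "s \<in> S" for s x
  proof (rule action_inv_eq[OF assms(1)])
    show "s \<in> carrier G"
      using that assms(2) by blast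
    show "h s (v, prepend (s, False) x) = (v, x)"
      unfolding S[OF that] using prepend_cancel[of "(s, False)" x] by simp
  qed
  have "h (letter_value G l) (v, w) = (v, l # w)"
    using l prepend_reduced[OF Cons.prems(2)]
    by (cases l; cases "snd l") (simp_all add: letter_value_def S inv)
  then show ?case
    using Cons w l by (simp add: action_mult[OF assms(1)])
qed

lemma word_value_consistent:
  assumes "subgroup H G" and "fst ` set w \<subseteq> H"
  shows "word_value (G\<lparr>carrier := H\<rparr>) w = word_value G w"
  using assms(2)
proof (induction w)
  case (Cons l w)
  then have "letter_value (G\<lparr>carrier := H\<rparr>) l = letter_value G l"
    using m_inv_consistent[OF assms(1), of "fst l"] by (simp add: letter_value_def)
  with Cons show ?case by simp
qed simp

lemma free_basis_generate:
  assumes "h \<in> hom G (BijGroup UNIV)" and "S \<subseteq> carrier G"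
    and "\<And>s x. s \<in> S \<Longrightarrow> h s (v, x) = (v, prepend (s, True) x)"
  shows "free_basis (G\<lparr>carrier := generate G S\<rparr>) S"
proof -
  have sub: "S \<subseteq> generate G S"
    by (rule subsetI) (rule generate.incl)
  have H: "subgroup (generate G S) G"
    using assms(2) by (rule generate_is_subgroup)
  show ?thesis
    unfolding free_basis_def
  proof (intro conjI allI impI)
    show "S \<subseteq> carrier (G\<lparr>carrier := generate G S\<rparr>)"
      using sub by simp
  next
    show "generate (G\<lparr>carrier := generate G S\<rparr>) S = carrier (G\<lparr>carrier := generate G S\<rparr>)"
      using generate_consistent[OF sub H] by simp
  next
    fix w assume "set w \<subseteq> S \<times> UNIV" and w': "reduced_word w" "w \<noteq> []"
    then have w: "fst ` set w \<subseteq> S" by (simp only: subset_Times_UNIV_iff)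
    have "h (word_value G w) (v, []) = (v, w)"
      by (rule action_word_value[OF assms w w'(1)])
    with w'(2) have "word_value G w \<noteq> \<one>"
      by (auto simp: action_one[OF assms(1)])
    moreover have "word_value (G\<lparr>carrier := generate G S\<rparr>) w = word_value G w"
      using w sub by (intro word_value_consistent[OF H]) (rule subset_trans)
    ultimately show "word_value (G\<lparr>carrier := generate G S\<rparr>) w
        \<noteq> \<one>\<^bsub>G\<lparr>carrier := generate G S\<rparr>\<^esub>"
      by simp
  qed
qed

end

section \<open>Primitive elements and simple elements\<close>

context group
begin

lemma comm_group_generate_singleton:
  assumes "g \<in> carrier G" and "carrier G = generate G {g}"
  shows "comm_group G"
proof (rule group_comm_groupI)
  fix x y assume "x \<in> carrier G" "y \<in> carrier G"
  then obtain i j :: int where "x = g [^] i" "y = g [^] j"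
    using assms generate_pow[OF assms(1)] by auto
  then show "x \<otimes> y = y \<otimes> x"
    using assms(1) by (simp add: add.commute flip: int_pow_mult)
qed

text \<open>The endomorphism that kills \<open>g\<close> and fixes the rest of \<open>S\<close> is
  trivial on the first subgroup and the identity on the second.\<close>

lemma free_basis_trivial_inter:
  assumes "free_basis G S" and "g \<in> S"
  shows "generate G {g} \<inter> generate G (S - {g}) = {\<one>}"
proof -
  have S: "S \<subseteq> carrier G"
    using assms(1) by (simp add: free_basis_def)
  then have "(\<lambda>s. if s = g then \<one> else s) \<in> S \<rightarrow> carrier G"
    by auto
  then obtain r where r: "r \<in> hom G G" "\<And>s. s \<in> S \<Longrightarrow> r s = (if s = g then \<one> else s)"
    by (rule free_basis_hom_exists[OF assms(1) is_group]) blast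
  interpret r: group_hom G G r
    by (intro group_hom.intro group_hom_axioms.intro is_group r(1))
  have A: "x \<in> carrier G \<and> r x = \<one>" if "x \<in> generate G {g}" for x
    using that
  proof induction
    case (eng x y)
    then show ?case by simp
  qed (use assms(2) S r(2)[OF assms(2)] in auto)
  have B: "x \<in> carrier G \<and> r x = x" if "x \<in> generate G (S - {g})" for x
    using that
  proof induction
    case (incl s)
    then show ?case using S r(2)[of s] by auto
  next
    case (inv s)
    then show ?case using S r(2)[of s] by auto
  next
    case (eng x y)
    then show ?case by simp
  qed simp
  show ?thesis
  proof (intro equalityI subsetI)
    fix x assume "x \<in> generate G {g} \<inter> generate G (S - {g})"
    then show "x \<in> {\<one>}"
      using A[of x] B[of x] by simp
  qed (simp add: generate.one)
qed

text \<open>Write each factor as a reduced word in the generators of its own side and concatenate.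
  Neighbouring factors use disjoint generators, so nothing cancels at the seams. The clause on
  \<open>hd w\<close> carries the side of the first factor through the induction.\<close>

lemma free_basis_split_word:
  assumes "free_basis G S" and "g \<in> S"
    and "A = generate G {g}" and "B = generate G (S - {g})"
    and "set xs \<subseteq> (A \<union> B) - {\<one>}"
    and "successively (\<lambda>x y. x \<in> A \<and> y \<in> B \<or> x \<in> B \<and> y \<in> A) xs" and "xs \<noteq> []"
  shows "\<exists>w. fst ` set w \<subseteq> S \<and> reduced_word w \<and> w \<noteq> [] \<and>
    (fst (hd w) = g \<longleftrightarrow> hd xs \<in> A) \<and> word_value G w = foldr (\<otimes>) xs \<one>"
  using assms(5-)
proof (induction xs)
  case (Cons x xs)
  have S: "S \<subseteq> carrier G"
    using assms(1) by (simp add: free_basis_def)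
  have AB: "y \<notin> A \<or> y \<notin> B" if "y \<noteq> \<one>" for y
    using that free_basis_trivial_inter[OF assms(1,2)] assms(3,4) by blast
  obtain T where T: "x \<in> generate G T" "T \<subseteq> S" "T = (if x \<in> A then {g} else S - {g})"
    using Cons.prems(1) assms(2-4) by (cases "x \<in> A") auto
  then obtain u where u: "fst ` set u \<subseteq> T" "reduced_word u" "word_value G u = x"
    using ex_reduced_word[OF subset_trans[OF T(2) S] T(1)] by blast
  have "u \<noteq> []"
    using u(3) Cons.prems(1) by auto
  have carr: "fst ` set u \<subseteq> carrier G" and "fst ` set u \<subseteq> S"
    using u(1) T(2) S by (auto dest!: subsetD)
  have "fst (hd u) \<in> T" "fst (last u) \<in> T"
    using u(1) \<open>u \<noteq> []\<close> by (auto simp: image_subset_iff)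
  show ?case
  proof (cases "xs = []")
    case True
    then show ?thesis
      using u T(3) \<open>u \<noteq> []\<close> \<open>fst ` set u \<subseteq> S\<close> \<open>fst (hd u) \<in> T\<close> carr
      by (intro exI[of _ u]) (auto split: if_splits)
  next
    case False
    then obtain w where w: "fst ` set w \<subseteq> S" "reduced_word w" "w \<noteq> []"
      "fst (hd w) = g \<longleftrightarrow> hd xs \<in> A" "word_value G w = foldr (\<otimes>) xs \<one>"
      using Cons by (auto simp: successively_Cons)
    have "hd xs \<in> set xs"
      using False by simp
    then have "x \<noteq> \<one>" "hd xs \<noteq> \<one>"
      using Cons.prems(1) by auto
    \<comment> \<open>No nontrivial element lies on both sides, so alternation really means changing
      sides.\<close>
    then have "x \<in> A \<longleftrightarrow> hd xs \<notin> A"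
      using Cons.prems(2) False AB by (auto simp: successively_Cons)
    then have "fst (last u) \<noteq> fst (hd w)"
      using \<open>fst (last u) \<in> T\<close> T(3) w(4) by (auto split: if_splits)
    then have "reduced_word (u @ w)"
      using u(2) w(2) by (simp add: reduced_word_def successively_append_iff)
    moreover have "word_value G (u @ w) = foldr (\<otimes>) (x # xs) \<one>"
      using w S carr u(3) by (simp add: word_value_append subset_trans)
    ultimately show ?thesis
      using \<open>u \<noteq> []\<close> \<open>fst ` set u \<subseteq> S\<close> w(1) \<open>fst (hd u) \<in> T\<close> T(3)
      by (intro exI[of _ "u @ w"]) (auto split: if_splits)
  qed
qed simp

text \<open>Noncommutativity makes the complementary factor nontrivial: otherwise \<open>g\<close>
  alone would generate the group.\<close>

theorem primitive_in_imp_simple_in: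
  assumes "primitive_in G g" and "\<not> comm_group G"
  shows "simple_in G g"
proof -
  obtain S where S: "free_basis G S" "g \<in> S" and g: "g \<in> carrier G" "g \<noteq> \<one>"
    using assms(1) by (auto simp: primitive_in_def)
  have sub: "S \<subseteq> carrier G" and gen: "generate G S = carrier G"
    using S(1) by (simp_all add: free_basis_def)
  define A where "A = generate G {g}"
  define B where "B = generate G (S - {g})"
  have A: "subgroup A G" and B: "subgroup B G"
    unfolding A_def B_def using g sub by (auto intro!: generate_is_subgroup)
  have "S \<subseteq> A \<union> B"
    by (auto simp: A_def B_def intro: generate.incl)
  moreover have "A \<union> B \<subseteq> carrier G"
    using A B by (simp add: subgroup.subset)
  ultimately have "generate G (A \<union> B) = carrier G"
    using mono_generate[of S "A \<union> B"] generate_incl[of "A \<union> B"] gen by blast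
  moreover have "foldr (\<otimes>) xs \<one> \<noteq> \<one>"
    if "set xs \<subseteq> (A \<union> B) - {\<one>}" "xs \<noteq> []"
      "successively (\<lambda>x y. x \<in> A \<and> y \<in> B \<or> x \<in> B \<and> y \<in> A) xs" for xs
    using free_basis_split_word[OF S A_def B_def that(1,3,2)] S(1)
    by (auto simp: free_basis_def subset_Times_UNIV_iff)
  ultimately have "internal_free_product G A B"
    using A B by (simp add: internal_free_product_def)
  moreover have "B \<noteq> {\<one>}"
  proof
    assume "B = {\<one>}"
    have "S \<subseteq> A"
    proof
      fix s assume "s \<in> S"
      then have "s = g \<or> s \<in> B"
        by (auto simp: B_def intro: generate.incl)
      then show "s \<in> A"
        using \<open>B = {\<one>}\<close> by (auto simp: A_def intro: generate.incl generate.one)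
    qed
    then have "carrier G = generate G {g}"
      using generate_subgroup_incl[OF \<open>S \<subseteq> A\<close> A] subgroup.subset[OF A] gen
      by (simp add: A_def subset_antisym)
    then show False
      using assms(2) comm_group_generate_singleton[OF g(1)] by blast
  qed
  moreover have "g \<in> A"
    by (simp add: A_def generate.incl)
  ultimately show ?thesis
    using assms g unfolding simple_in_def primitive_in_def by blast
qed

section \<open>Finite-index subgroups are not commutative\<close>

lemma finite_index_pow_mem:
  assumes "subgroup H G" and "finite (rcosets H)" and x: "x \<in> carrier G"
  obtains m :: nat where "m > 0" "x [^] m \<in> H"
proof -
  \<comment> \<open>Pigeonhole: the powers of \<open>x\<close> meet only finitely many cosets, and
    two exponents with the same coset differ by a suitable \<open>m\<close>.\<close>
  have "range (\<lambda>i::nat. H #> x [^] i) \<subseteq> rcosets H"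
    using assms by (auto intro!: rcosetsI subgroup.subset)
  then have "\<not> inj (\<lambda>i::nat. H #> x [^] i)"
    using assms(2) finite_subset finite_imageD by (metis infinite_UNIV_nat)
  then obtain i j :: nat where ij: "i < j" "H #> x [^] i = H #> x [^] j"
    by (metis injI linorder_neqE_nat)
  have "x [^] j = x [^] (j - i) \<otimes> x [^] i"
    using ij(1) x by (simp add: nat_pow_mult)
  then have "x [^] j \<otimes> inv (x [^] i) = x [^] (j - i)"
    using x by (simp add: m_assoc)
  moreover have "H #> (x [^] j \<otimes> inv (x [^] i)) = H"
    using ij(2) x assms(1) by (intro coset_mult_inv2) (auto simp: subgroup.subset)
  ultimately have "x [^] (j - i) \<in> H"
    using coset_join1 assms(1) x by simp
  with ij(1) show thesis
    by (intro that[of "j - i"]) auto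
qed

lemma word_value_replicate:
  "x \<in> carrier G \<Longrightarrow> word_value G (replicate n (x, e)) = (if e then x else inv x) [^] n"
proof (induction n)
  case (Suc n)
  moreover have "y \<otimes> y [^] n = y [^] n \<otimes> y" if "y \<in> carrier G" for y
    using that by (metis nat_pow_Suc nat_pow_Suc2)
  ultimately show ?case
    by (simp add: letter_value_def)
qed simp

lemma reduced_word_replicate: "reduced_word (replicate n l)"
  unfolding reduced_word_def by (induction n) (auto simp: successively_Cons)

text \<open>Positive powers of \<open>a\<close> and \<open>b\<close> lie in \<open>H\<close>, and
  their commutator is spelled by a nonempty reduced word, so they do not commute.\<close>

lemma finite_index_not_comm:
  assumes "free_basis G {a, b}" and "a \<noteq> b" and H: "subgroup H G" "finite (rcosets H)"
  shows "\<not> comm_group (G\<lparr>carrier := H\<rparr>)"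
proof
  assume "comm_group (G\<lparr>carrier := H\<rparr>)"
  then have comm: "x \<otimes> y = y \<otimes> x" if "x \<in> H" "y \<in> H" for x y
    using that comm_monoid.m_comm[OF comm_group.axioms(1)] by fastforce
  have [simp]: "a \<in> carrier G" "b \<in> carrier G"
    using assms(1) by (auto simp: free_basis_def)
  obtain m k :: nat where mk: "m > 0" "a [^] m \<in> H" "k > 0" "b [^] k \<in> H"
    using finite_index_pow_mem[OF H] by (metis \<open>a \<in> carrier G\<close> \<open>b \<in> carrier G\<close>)
  let ?w = "replicate m (a, True) @ replicate k (b, True) @
    replicate m (a, False) @ replicate k (b, False)"
  have "word_value G ?w = a [^] m \<otimes> (b [^] k \<otimes> (inv (a [^] m) \<otimes> inv (b [^] k)))"
    by (simp add: word_value_append word_value_replicate nat_pow_inv set_replicate_conv_if)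
  also have "\<dots> = \<one>"
    using comm[OF mk(4,2)] by (simp flip: inv_mult_group m_assoc)
  finally have "word_value G ?w = \<one>" .
  moreover have "reduced_word ?w"
    using mk(1,3) assms(2)
    by (simp add: reduced_word_replicate[unfolded reduced_word_def] reduced_word_def
        successively_append_iff hd_append)
  moreover have "set ?w \<subseteq> {a, b} \<times> UNIV" "?w \<noteq> []"
    using mk by auto
  ultimately show False
    using assms(1) unfolding free_basis_def by blast
qed

end

text \<open>Every subgroup admissible for primitivity is noncommutative, hence admissible for
  simplicity; the infimum for \<open>d_simp\<close> runs over a larger set.\<close>

lemma d_simp_le_d_prim:
  assumes "group F" and "free_basis F {a, b}" and "a \<noteq> b"
  shows "d_simp g F \<le> d_prim g F"
  unfolding d_simp_def d_prim_def
proof (rule Inf_superset_mono, safe)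
  fix H assume H: "finite_index_subgroup F H" "g \<in> H" "primitive_in (F\<lparr>carrier := H\<rparr>) g"
  interpret group F by fact
  have "\<not> comm_group (F\<lparr>carrier := H\<rparr>)"
    using finite_index_not_comm[OF assms(2,3)] H(1) by (simp add: finite_index_subgroup_def)
  then have "simple_in (F\<lparr>carrier := H\<rparr>) g"
    using group.primitive_in_imp_simple_in[OF subgroup_imp_group H(3)] H(1)
    by (simp add: finite_index_subgroup_def)
  with H show "\<exists>H'. enat (card (rcosets\<^bsub>F\<^esub> H)) = enat (card (rcosets\<^bsub>F\<^esub> H')) \<and>
      finite_index_subgroup F H' \<and> g \<in> H' \<and> simple_in (F\<lparr>carrier := H'\<rparr>) g"
    by blast
qed

section \<open>Counting cosets\<close>

context group
begin

text \<open>Right multiplication by \<open>inv x\<close> is injective on the finite set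
  \<open>\<C>\<close>, hence onto, so \<open>\<C>\<close> is closed under \<open>x\<close> as well.
  Starting from \<open>H\<close>, every coset is then reached inside \<open>\<C>\<close>.\<close>

lemma rcosets_subset_closed:
  assumes H: "subgroup H G" and X: "X \<subseteq> carrier G" "generate G X = carrier G"
    and "finite \<C>" and \<C>: "\<And>C. C \<in> \<C> \<Longrightarrow> C \<subseteq> carrier G" and "H \<in> \<C>"
    and closed: "\<And>C x. C \<in> \<C> \<Longrightarrow> x \<in> X \<Longrightarrow> C #> inv x \<in> \<C>"
  shows "rcosets H \<subseteq> \<C>"
proof -
  have step: "x \<in> carrier G \<and> (\<forall>C \<in> \<C>. C #> x \<in> \<C>)" if "x \<in> generate G X" for x
    using that
  proof induction
    case one
    then show ?case using \<C> by simp
  next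
    case (incl x)
    then have x: "x \<in> carrier G" using X by blast
    have undo: "C #> inv x #> x = C" if "C \<in> \<C>" for C
      using x \<C>[OF that] by (simp add: coset_mult_assoc)
    have "inj_on (\<lambda>C. C #> inv x) \<C>"
      by (rule inj_on_inverseI[of _ "\<lambda>C. C #> x"]) (rule undo)
    then have surj: "(\<lambda>C. C #> inv x) ` \<C> = \<C>"
      using assms(4) closed incl by (intro endo_inj_surj) auto
    have "C #> x \<in> \<C>" if "C \<in> \<C>" for C
    proof -
      from that have "C \<in> (\<lambda>C. C #> inv x) ` \<C>"
        by (simp only: surj)
      then show ?thesis using undo by (elim imageE) simp
    qed
    with x show ?case by blast
  next
    case (inv x)
    then show ?case using X closed by blast
  next
    case (eng x y)
    have "C #> (x \<otimes> y) = C #> x #> y" if "C \<in> \<C>" for C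
      using eng \<C>[OF that] by (simp add: coset_mult_assoc)
    with eng show ?case by simp
  qed
  show ?thesis
    using step X(2) assms(6) by (auto simp: RCOSETS_def)
qed

text \<open>Read from right to left, as for a left action: the path \<open>x [^] i\<close>, the loop
  \<open>y\<close> at its end, and the way back.\<close>

definition conj_pow :: "'a \<Rightarrow> 'a \<Rightarrow> nat \<Rightarrow> 'a" where
  "conj_pow x y i = inv (x [^] i) \<otimes> y \<otimes> x [^] i"

lemma conj_pow_closed [simp]:
  "x \<in> carrier G \<Longrightarrow> y \<in> carrier G \<Longrightarrow> conj_pow x y i \<in> carrier G"
  by (simp add: conj_pow_def)

text \<open>The coset \<open>H #> inv (x [^] i)\<close> plays the vertex that \<open>x [^] i\<close>
  reaches from the base point; the inverse turns left cosets into right ones.\<close>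

lemma coset_inv_pow_mod:
  fixes i m :: nat
  assumes H: "subgroup H G" and x: "x \<in> carrier G" and "x [^] m \<in> H"
  shows "H #> inv (x [^] i) = H #> inv (x [^] (i mod m))"
proof -
  have "x [^] i = x [^] (i mod m) \<otimes> (x [^] m) [^] (i div m)"
    by (simp only: nat_pow_pow[OF x] nat_pow_mult[OF x] mod_mult_div_eq)
  then have "inv (x [^] i) = inv ((x [^] m) [^] (i div m)) \<otimes> inv (x [^] (i mod m))"
    using x by (simp add: inv_mult_group)
  moreover have "(x [^] m) [^] k \<in> H" for k :: nat
    using assms(3) by (induction k)
      (simp_all add: subgroup.one_closed[OF H] subgroup.m_closed[OF H])
  then have "H #> inv ((x [^] m) [^] (i div m)) = H"
    using H x by (intro coset_join2) (auto simp: subgroup.m_inv_closed)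
  ultimately show ?thesis
    using H x by (simp add: subgroup.subset flip: coset_mult_assoc)
qed

text \<open>Multiplying by \<open>inv x\<close> follows an edge labelled \<open>x\<close>. It
  advances along the \<open>x\<close>-cycle, which contains the vertices \<open>0\<close> and
  \<open>s\<close> of the \<open>y\<close>-cycle; at the other vertices of the
  \<open>y\<close>-cycle it is a loop, since \<open>conj_pow y x j \<in> H\<close> fixes the
  coset.\<close>

lemma coset_inv_pow_step:
  fixes m s p :: nat
  assumes H: "subgroup H G" and x: "x \<in> carrier G" and y: "y \<in> carrier G"
    and "y [^] m \<in> H" and "m > 0"
    and eq: "H #> inv (y [^] s) = H #> inv (x [^] p)"
    and conj: "\<And>j. 0 < j \<Longrightarrow> j < m \<Longrightarrow> j \<noteq> s \<Longrightarrow> conj_pow y x j \<in> H"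
    and C: "C \<in> range (\<lambda>i::nat. H #> inv (x [^] i)) \<union> range (\<lambda>j::nat. H #> inv (y [^] j))"
  shows "C #> inv x \<in> range (\<lambda>i::nat. H #> inv (x [^] i)) \<union> range (\<lambda>j::nat. H #> inv (y [^] j))"
proof -
  have sub: "H \<subseteq> carrier G" using H by (rule subgroup.subset)
  have step: "H #> inv (x [^] i) #> inv x = H #> inv (x [^] Suc i)" for i
    using x sub by (simp only: coset_mult_assoc nat_pow_Suc2 inv_mult_group inv_closed nat_pow_closed)
  from C consider i :: nat where "C = H #> inv (x [^] i)" | j :: nat where "C = H #> inv (y [^] j)"
    by blast
  then show ?thesis
  proof cases
    case 1
    then show ?thesis by (auto simp only: step)
  next
    case (2 j)
    define k where "k = j mod m"
    have C: "C = H #> inv (y [^] k)" and "k < m"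
      using 2 coset_inv_pow_mod[OF H y assms(4)] assms(5) by (simp_all add: k_def)
    consider "k = 0" | "k = s" | "0 < k" "k \<noteq> s" by blast
    then show ?thesis
    proof cases
      case 1
      then have "C = H #> inv (x [^] (0::nat))" by (simp add: C)
      then show ?thesis by (auto simp only: step)
    next
      case 2
      then have "C = H #> inv (x [^] p)" using eq C by simp
      then show ?thesis by (auto simp only: step)
    next
      case 3
      then have "inv (conj_pow y x k) \<in> H"
        using conj \<open>k < m\<close> H by (simp add: subgroup.m_inv_closed)
      then have "H #> inv (conj_pow y x k) = H"
        using H sub by (intro coset_join2) auto
      moreover have "inv (y [^] k) \<otimes> inv x = inv (conj_pow y x k) \<otimes> inv (y [^] k)"
        using x y by (simp add: conj_pow_def inv_mult_group m_assoc)
      moreover have "C #> inv x = H #> (inv (y [^] k) \<otimes> inv x)"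
        using x y sub by (simp add: C coset_mult_assoc)
      moreover have "H #> (inv (conj_pow y x k) \<otimes> inv (y [^] k)) =
          H #> inv (conj_pow y x k) #> inv (y [^] k)"
        using x y sub by (simp add: coset_mult_assoc)
      ultimately have "C #> inv x = C"
        by (simp add: C)
      with 2 show ?thesis by simp
    qed
  qed
qed

end

section \<open>The permutation action of the free group\<close>

text \<open>After \<open>n\<close> steps on a cycle of length \<open>d\<close>, these further steps
  lead back to the start; this places the second common vertex.\<close>

lemma add_diff_mod_self:
  fixes d n :: nat
  assumes "d > 0"
  shows "(n + (d - n mod d)) mod d = 0"
proof -
  have "n + (d - n mod d) = d * (n div d) + (n mod d + (d - n mod d))"
    by simp
  also have "\<dots> = d * Suc (n div d)"
    using assms by simp
  finally show ?thesis by simp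
qed

text \<open>Points are pairs of a vertex and a fibre element. The vertices \<open>0, \<dots>, m - 1\<close> form the cycle,
  every other vertex \<open>k\<close> carries a loop labelled \<open>Q k\<close>.\<close>

definition cyc :: "nat \<Rightarrow> ('x \<Rightarrow> 'x) \<Rightarrow> (int \<Rightarrow> 'x \<Rightarrow> 'x) \<Rightarrow> int \<times> 'x \<Rightarrow> int \<times> 'x" where
  "cyc m R Q = (\<lambda>(k, x).
     if 0 \<le> k \<and> k < int m then if k + 1 = int m then (0, R x) else (k + 1, x)
     else (k, Q k x))"

lemma bij_cyc:
  assumes "m > 0" and R: "bij R" and Q: "\<And>k. bij (Q k)"
  shows "bij (cyc m R Q)"
proof (rule o_bij)
  let ?inv = "\<lambda>(k, y).
    if 0 \<le> k \<and> k < int m then if k = 0 then (int m - 1, Hilbert_Choice.inv R y) else (k - 1, y)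
    else (k, Hilbert_Choice.inv (Q k) y)"
  have [simp]: "R (Hilbert_Choice.inv R x) = x" "Hilbert_Choice.inv R (R x) = x"
      "Q k (Hilbert_Choice.inv (Q k) x) = x" "Hilbert_Choice.inv (Q k) (Q k x) = x" for k x
    using R Q by (simp_all add: bij_is_inj bij_is_surj surj_f_inv_f)
  show "?inv \<circ> cyc m R Q = id" "cyc m R Q \<circ> ?inv = id"
    using assms(1) by (auto simp: cyc_def fun_eq_iff)
qed

text \<open>Each full turn crosses the edge carrying \<open>R\<close> once.\<close>

lemma cyc_funpow:
  assumes "m > 0"
  shows "(cyc m R Q ^^ n) (0, x) = (int (n mod m), (R ^^ (n div m)) x)"
proof (induction n)
  case (Suc n)
  have "n mod m < m" using assms by simp
  then show ?case
    using Suc by (auto simp: cyc_def mod_Suc div_Suc)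
qed simp

text \<open>Places a second cycle on the vertices \<open>0, -1, -2, \<dots>\<close>, except that its vertex \<open>s\<close> is glued to the
  vertex \<open>p\<close> of the first cycle, with fibres identified by \<open>D\<close>. The vertex \<open>- s\<close>, which becomes
  isolated, is the image of \<open>- p\<close> so that the map is a bijection.\<close>

definition cross :: "nat \<Rightarrow> nat \<Rightarrow> ('x \<Rightarrow> 'x) \<Rightarrow> int \<times> 'x \<Rightarrow> int \<times> 'x" where
  "cross s p D = (\<lambda>(k, x).
     if k = int s then (int p, D x) else if k = - int p then (- int s, x) else (- k, x))"

lemma bij_cross:
  assumes "s > 0" "p > 0" and D: "bij D"
  shows "bij (cross s p D)"
proof (rule o_bij)
  let ?inv = "\<lambda>(k, y).
    if k = int p then (int s, Hilbert_Choice.inv D y) else if k = - int s then (- int p, y) else (- k, y)"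
  have [simp]: "D (Hilbert_Choice.inv D x) = x" "Hilbert_Choice.inv D (D x) = x" for x
    using D by (simp_all add: bij_is_inj bij_is_surj surj_f_inv_f)
  show "?inv \<circ> cross s p D = id" "cross s p D \<circ> ?inv = id"
    using assms(1,2) by (auto simp: cross_def fun_eq_iff)
qed

lemma funpow_conjugate:
  assumes "bij c"
  shows "((c \<circ> f \<circ> Hilbert_Choice.inv c) ^^ n) (c x) = c ((f ^^ n) x)"
proof (induction n)
  case (Suc n)
  have "Hilbert_Choice.inv c (c y) = y" for y
    using assms by (simp add: bij_is_inj)
  with Suc show ?case by (simp only: funpow.simps o_apply)
qed simp

section \<open>The generators of the subgroup and their action\<close>

context group
begin

text \<open>The \<open>a\<close>-cycle and the \<open>b\<close>-cycle share the base point and the vertex at position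
  \<open>t mod d'\<close> on the \<open>b\<close>-cycle and \<open>d - n mod d\<close> on the \<open>a\<close>-cycle, so that \<open>a\<^sup>n b\<^sup>t\<close>, acting from the left,
  returns to the base point.\<close>

definition cycles_basis :: "'a \<Rightarrow> 'a \<Rightarrow> nat \<Rightarrow> nat \<Rightarrow> nat \<Rightarrow> nat \<Rightarrow> 'a set" where
  "cycles_basis a b d d' n t =
     {a [^] d, b [^] d', a [^] n \<otimes> b [^] t}
     \<union> conj_pow a b ` ({0<..<d} - {d - n mod d})
     \<union> conj_pow b a ` ({0<..<d'} - {t mod d'})"

lemma cycles_basis_subset:
  "a \<in> carrier G \<Longrightarrow> b \<in> carrier G \<Longrightarrow> cycles_basis a b d d' n t \<subseteq> carrier G"
  by (auto simp: cycles_basis_def)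

text \<open>Both legs of the path leave the fibre coordinate alone, so only the loop at
  \<open>v\<close> contributes.\<close>

lemma action_conj_pow:
  assumes h: "h \<in> hom G (BijGroup UNIV)" and "x \<in> carrier G" "y \<in> carrier G"
    and "\<And>z. h (x [^] i) (u, z) = (v, z)" and "\<And>z. h y (v, z) = (v, L z)"
  shows "h (conj_pow x y i) (u, z) = (u, L z)"
  using assms(2,3) action_inv_eq[OF h _ assms(4)]
  by (simp add: conj_pow_def action_mult[OF h] assms(4,5))

text \<open>Every edge carries a permutation of the reduced words over \<^term>\<open>cycles_basis a b d d' n t\<close>,
  and a path acts by the product of its labels. The wrap-around edges carry \<open>a\<^sup>d\<close> and \<open>b\<^sup>d'\<close>, the
  loops carry their own generators, and the twist \<open>D\<close> at the second common vertex is the solution of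
  the equation saying that the closed path \<open>a\<^sup>n b\<^sup>t\<close> carries the generator \<open>a\<^sup>n b\<^sup>t\<close>.\<close>

lemma cycles_basis_action:
  fixes d d' n t :: nat
  assumes ab: "free_basis G {a, b}" "a \<noteq> b"
    and d: "d > 0" "\<not> d dvd n" and d': "d' > 0" "\<not> d' dvd t"
  obtains h :: "'a \<Rightarrow> int \<times> ('a \<times> bool) list \<Rightarrow> int \<times> ('a \<times> bool) list"
  where "h \<in> hom G (BijGroup UNIV)"
    and "\<And>s x. s \<in> cycles_basis a b d d' n t \<Longrightarrow> h s (0, x) = (0, prepend (s, True) x)"
proof -
  have carr: "a \<in> carrier G" "b \<in> carrier G"
    using ab(1) by (auto simp: free_basis_def)
  define p where "p = d - n mod d"
  define s where "s = t mod d'"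
  have p: "0 < p" "p < d" and s: "0 < s" "s < d'"
    using d d' by (simp_all add: p_def s_def dvd_eq_mod_eq_0)
  have np: "(n + p) mod d = 0"
    using d(1) unfolding p_def by (rule add_diff_mod_self)
  let ?P = "\<lambda>x. prepend (x, True)"
  let ?A = "?P (a [^] d)" and ?C = "?P (b [^] d')"
  define D where "D = Hilbert_Choice.inv (?A ^^ ((n + p) div d)) \<circ>
    ?P (a [^] n \<otimes> b [^] t) \<circ> Hilbert_Choice.inv (?C ^^ (t div d'))"
  \<comment> \<open>The \<open>a\<close>-cycle occupies \<open>0\<close> to \<open>d - 1\<close>; a
    vertex \<open>- j\<close> of the \<open>b\<close>-cycle off the \<open>a\<close>-cycle has an
    \<open>a\<close>-loop carrying \<open>conj_pow b a j\<close>.\<close>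
  define \<alpha> where "\<alpha> = cyc d ?A (\<lambda>k. ?P (conj_pow b a (nat (- k))))"
  \<comment> \<open>In its own coordinates the \<open>b\<close>-cycle occupies \<open>0\<close> to
    \<open>d' - 1\<close>; conjugation by \<open>c\<close> moves it into place.\<close>
  define \<beta>' where "\<beta>' = cyc d' ?C (\<lambda>k. ?P (conj_pow a b (nat (- k))))"
  define c where "c = cross s p D"
  define \<beta> where "\<beta> = c \<circ> \<beta>' \<circ> Hilbert_Choice.inv c"
  have bijs: "bij (?A ^^ i)" "bij (?C ^^ i)" for i
    by (simp_all add: bij_prepend)
  have "bij D"
    unfolding D_def by (intro bij_comp bij_imp_bij_inv bijs bij_prepend)
  then have c: "bij c"
    unfolding c_def using p s by (intro bij_cross)
  have "bij \<alpha>" "bij \<beta>'"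
    unfolding \<alpha>_def \<beta>'_def using d d' by (auto intro: bij_cyc bij_prepend)
  then have "bij \<beta>"
    unfolding \<beta>_def using c by (intro bij_comp bij_imp_bij_inv)
  define f where "f x = (if x = a then \<alpha> else \<beta>)" for x
  have "f \<in> {a, b} \<rightarrow> carrier (BijGroup UNIV)"
    using \<open>bij \<alpha>\<close> \<open>bij \<beta>\<close> by (auto simp: f_def carrier_BijGroup_UNIV)
  then obtain h where h: "h \<in> hom G (BijGroup UNIV)" and "\<And>x. x \<in> {a, b} \<Longrightarrow> h x = f x"
    by (rule free_basis_hom_exists[OF ab(1) group_BijGroup]) blast
  then have ha: "h a = \<alpha>" and hb: "h b = \<beta>"
    using ab(2) by (simp_all add: f_def)
  have apow: "h (a [^] i) (0, x) = (int (i mod d), (?A ^^ (i div d)) x)" for i x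
    using d(1) by (simp add: action_pow[OF h] carr ha \<alpha>_def cyc_funpow)
  have c0: "c (0, x) = (0, x)" for x
    using p s by (simp add: c_def cross_def)
  have bpow: "h (b [^] i) (0, x) = c (int (i mod d'), (?C ^^ (i div d')) x)" for i x
  proof -
    have "h (b [^] i) (0, x) = (\<beta> ^^ i) (c (0, x))"
      by (simp add: action_pow[OF h] carr hb c0)
    also have "\<dots> = c ((\<beta>' ^^ i) (0, x))"
      unfolding \<beta>_def by (rule funpow_conjugate[OF c])
    finally show ?thesis
      using d'(1) by (simp add: \<beta>'_def cyc_funpow)
  qed
  have g: "h (a [^] n \<otimes> b [^] t) (0, x) = (0, ?P (a [^] n \<otimes> b [^] t) x)" for x
  proof -
    \<comment> \<open>Vertex \<open>int p\<close> is reached by \<open>a [^] p\<close> before any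
      turn is completed, so \<open>a [^] n\<close> from there closes up after
      \<open>(n + p) div d\<close> turns.\<close>
    have shift: "h (a [^] n) (int p, y) = (0, (?A ^^ ((n + p) div d)) y)" for y
    proof -
      have "(int p, y) = h (a [^] p) (0, y)"
        using p by (simp add: apow)
      then have "h (a [^] n) (int p, y) = h (a [^] (n + p)) (0, y)"
        by (simp only: nat_pow_mult[OF carr(1), symmetric] action_mult[OF h] nat_pow_closed carr o_apply)
      then show ?thesis
        by (simp only: apow np of_nat_0)
    qed
    have "h (b [^] t) (0, x) = (int p, D ((?C ^^ (t div d')) x))"
      by (simp add: bpow c_def cross_def flip: s_def)
    then have "h (a [^] n \<otimes> b [^] t) (0, x) =
        (0, (?A ^^ ((n + p) div d)) (D ((?C ^^ (t div d')) x)))"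
      by (simp only: action_mult[OF h] nat_pow_closed carr o_apply shift)
    also have "(?A ^^ ((n + p) div d)) (D ((?C ^^ (t div d')) x)) = ?P (a [^] n \<otimes> b [^] t) x"
      unfolding D_def o_apply
      using bijs(1)[THEN bij_is_surj, THEN surj_f_inv_f] bijs(2)[THEN bij_is_inj, THEN inv_f_f]
      by simp
    finally show ?thesis .
  qed
  have conj_a: "h (conj_pow a b i) (0, x) = (0, ?P (conj_pow a b i) x)"
    if i: "0 < i" "i < d" "i \<noteq> p" for i x
  proof (rule action_conj_pow[OF h carr, where v = "int i"])
    show "h (a [^] i) (0, z) = (int i, z)" for z
      using i by (simp add: apow)
    \<comment> \<open>As \<open>i \<noteq> p\<close>, \<open>c\<close> merely reflects
      \<open>- i\<close> to \<open>i\<close>, so the \<open>b\<close>-loop at vertex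
      \<open>i\<close> is the loop of \<open>\<beta>'\<close> at \<open>- i\<close>.\<close>
    have cross_i: "c (- int i, y) = (int i, y)" for y
      using i s by (simp add: c_def cross_def)
    then have "Hilbert_Choice.inv c (int i, y) = (- int i, y)" for y
      using c by (metis bij_is_inj inv_f_f)
    then show "h b (int i, z) = (int i, ?P (conj_pow a b i) z)" for z
      using i by (simp add: hb \<beta>_def \<beta>'_def cyc_def cross_i)
  qed
  have conj_b: "h (conj_pow b a j) (0, x) = (0, ?P (conj_pow b a j) x)"
    if j: "0 < j" "j < d'" "j \<noteq> s" for j x
  proof (rule action_conj_pow[OF h carr(2,1), where v = "- int j"])
    show "h (b [^] j) (0, z) = (- int j, z)" for z
      using j p by (simp add: bpow c_def cross_def)
    show "h a (- int j, z) = (- int j, ?P (conj_pow b a j) z)" for z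
      using j by (simp add: ha \<alpha>_def cyc_def)
  qed
  have "h x (0, y) = (0, ?P x y)" if "x \<in> cycles_basis a b d d' n t" for x y
    using that unfolding cycles_basis_def p_def[symmetric] s_def[symmetric]
  proof (elim UnE insertE imageE emptyE)
    assume "x = a [^] d"
    then show ?thesis using d(1) by (simp add: apow)
  next
    assume "x = b [^] d'"
    then show ?thesis using d'(1) by (simp add: bpow c0)
  qed (auto simp: g conj_a conj_b)
  with h show thesis by (rule that)
qed

section \<open>Bounding the index by counting vertices\<close>

lemma cycles_basis_index:
  fixes d d' n t :: nat
  assumes ab: "{a, b} \<subseteq> carrier G" "generate G {a, b} = carrier G"
    and d: "d > 0" "\<not> d dvd n" and d': "d' > 0" "\<not> d' dvd t"
  defines "H \<equiv> generate G (cycles_basis a b d d' n t)"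
  shows "finite (rcosets H) \<and> card (rcosets H) \<le> d + d' - 2"
proof -
  have a: "a \<in> carrier G" and b: "b \<in> carrier G"
    using ab(1) by simp_all
  define p where "p = d - n mod d"
  define s where "s = t mod d'"
  have p: "0 < p" "p < d" and s: "0 < s" "s < d'"
    using d d' by (simp_all add: p_def s_def dvd_eq_mod_eq_0)
  have H: "subgroup H G"
    unfolding H_def by (intro generate_is_subgroup cycles_basis_subset a b)
  then have sub: "H \<subseteq> carrier G"
    by (rule subgroup.subset)
  have mem: "x \<in> H" if "x \<in> cycles_basis a b d d' n t" for x
    unfolding H_def using that by (rule generate.incl)
  have ad: "a [^] d \<in> H" and bd: "b [^] d' \<in> H" and g: "a [^] n \<otimes> b [^] t \<in> H"
    by (simp_all add: mem cycles_basis_def)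
  have conj_a: "conj_pow a b i \<in> H" if "0 < i" "i < d" "i \<noteq> p" for i
    using that by (intro mem) (auto simp: cycles_basis_def p_def)
  have conj_b: "conj_pow b a j \<in> H" if "0 < j" "j < d'" "j \<noteq> s" for j
    using that by (intro mem) (auto simp: cycles_basis_def s_def)
  \<comment> \<open>The glueing in terms of cosets: \<open>a [^] n \<otimes> b [^] t \<in> H\<close>
    turns \<open>H #> inv (b [^] t)\<close> into \<open>H #> a [^] n\<close>, and
    \<open>a [^] (p + n)\<close>, a power of \<open>a [^] d\<close>, turns that into
    \<open>H #> inv (a [^] p)\<close>.\<close>
  have meet: "H #> inv (b [^] s) = H #> inv (a [^] p)"
  proof -
    have t: "H #> inv (b [^] s) = H #> inv (b [^] t)"
      unfolding s_def using coset_inv_pow_mod[OF H b bd] by metis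
    have "(n + p) mod d = 0"
      using d(1) unfolding p_def by (rule add_diff_mod_self)
    then have np: "H #> inv (a [^] (p + n)) = H"
      using coset_inv_pow_mod[OF H a ad, of "p + n"] sub by (simp add: add.commute)
    have "H #> inv (b [^] t) = H #> inv (a [^] n \<otimes> b [^] t) #> a [^] n"
      using a b sub by (simp add: coset_mult_assoc inv_mult_group m_assoc)
    also have "\<dots> = H #> a [^] n"
      using H g a b by (simp add: coset_join2 subgroup.m_inv_closed)
    also have "\<dots> = H #> inv (a [^] (p + n)) #> a [^] n"
      by (simp only: np)
    also have "\<dots> = H #> inv (a [^] p)"
    proof -
      have "inv (a [^] (p + n)) \<otimes> a [^] n = inv (a [^] p)"
        using a by (simp add: add.commute[of p n] m_assoc inv_mult_group flip: nat_pow_mult)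
      then show ?thesis
        using a sub by (simp add: coset_mult_assoc)
    qed
    finally show ?thesis using t by simp
  qed
  define \<C> where "\<C> = range (\<lambda>i::nat. H #> inv (a [^] i)) \<union> range (\<lambda>j::nat. H #> inv (b [^] j))"
  \<comment> \<open>The \<open>d\<close> vertices of the \<open>a\<close>-cycle and the
    \<open>d' - 2\<close> vertices of the \<open>b\<close>-cycle other than \<open>0\<close> and
    \<open>s\<close>; repetitions do not affect an upper bound.\<close>
  let ?R = "(\<lambda>i. H #> inv (a [^] i)) ` {..<d} \<union> (\<lambda>j. H #> inv (b [^] j)) ` ({0<..<d'} - {s})"
  have "\<C> \<subseteq> ?R"
  proof -
    have "H #> inv (a [^] i) \<in> ?R" for i :: nat
      using coset_inv_pow_mod[OF H a ad, of i] d(1) by (intro UnI1 image_eqI[of _ _ "i mod d"]) auto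
    moreover have "H #> inv (b [^] j) \<in> ?R" for j :: nat
    proof -
      define k where "k = j mod d'"
      have "k < d'" and j: "H #> inv (b [^] j) = H #> inv (b [^] k)"
        using coset_inv_pow_mod[OF H b bd, of j] d'(1) by (simp_all add: k_def)
      consider "k = 0" | "k = s" | "0 < k" "k \<noteq> s" by blast
      then show ?thesis
      proof cases
        case 1
        then have "H #> inv (b [^] j) = H #> inv (a [^] (0::nat))"
          by (simp add: j)
        with d(1) show ?thesis by blast
      next
        case 2
        then have "H #> inv (b [^] j) = H #> inv (a [^] p)"
          by (simp add: j meet)
        with p(2) show ?thesis by blast
      next
        case 3
        with \<open>k < d'\<close> j show ?thesis by auto
      qed
    qed
    ultimately show ?thesis
      unfolding \<C>_def by blast
  qed
  have "rcosets H \<subseteq> \<C>"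
  proof (rule rcosets_subset_closed[OF H ab])
    show "finite \<C>"
      using \<open>\<C> \<subseteq> ?R\<close> by (rule finite_subset) simp
    show "C \<subseteq> carrier G" if "C \<in> \<C>" for C
      using that unfolding \<C>_def
      by (elim UnE rangeE) (simp_all add: r_coset_subset_G[OF sub] a b)
    show "H \<in> \<C>"
      unfolding \<C>_def using sub by (intro UnI1 range_eqI[of _ _ 0]) simp
    show "C #> inv x \<in> \<C>" if "C \<in> \<C>" "x \<in> {a, b}" for C x
      using that(2)
    proof (elim insertE emptyE)
      assume "x = a"
      with that(1) show ?thesis
        unfolding \<C>_def using coset_inv_pow_step[OF H a b bd d'(1) meet conj_b] by simp
    next
      assume "x = b"
      with that(1) show ?thesis
        unfolding \<C>_def
        using coset_inv_pow_step[OF H b a ad d(1) meet[symmetric] conj_a] by (simp add: Un_commute)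
    qed
  qed
  with \<open>\<C> \<subseteq> ?R\<close> have R: "rcosets H \<subseteq> ?R" by blast
  have "card ?R \<le> card {..<d} + card ({0<..<d'} - {s})"
    by (intro order_trans[OF card_Un_le] add_mono card_image_le) auto
  also have "\<dots> = d + d' - 2"
    using s by simp
  finally have "card ?R \<le> d + d' - 2" .
  moreover have "card (rcosets H) \<le> card ?R"
    using R by (intro card_mono) auto
  moreover have "finite (rcosets H)"
    using R by (rule finite_subset) auto
  ultimately show ?thesis by simp
qed

lemma free_basis_not_one:
  assumes "free_basis G S" and "s \<in> S"
  shows "s \<noteq> \<one>"
proof
  assume "s = \<one>"
  then have "word_value G [(s, True)] = \<one>"
    by (simp add: letter_value_def)
  then show False
    using assms unfolding free_basis_def reduced_word_def
    by (metis (no_types, lifting) SigmaI UNIV_I empty_subsetI insert_subset list.distinct(1)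
        list.simps(15) list.set(1) successively.simps(2))
qed

end

section \<open>The bound for the primitivity index\<close>

lemma d_prim_le:
  fixes F :: "('a, 'b) monoid_scheme" and d d' n t :: nat
  assumes "group F" and ab: "free_basis F {a, b}" "a \<noteq> b"
    and d: "d > 0" "\<not> d dvd n" and d': "d' > 0" "\<not> d' dvd t"
  shows "d_prim (a [^]\<^bsub>F\<^esub> n \<otimes>\<^bsub>F\<^esub> b [^]\<^bsub>F\<^esub> t) F \<le> enat (d + d' - 2)"
proof -
  interpret group F by fact
  let ?S = "cycles_basis a b d d' n t" and ?g = "a [^]\<^bsub>F\<^esub> n \<otimes>\<^bsub>F\<^esub> b [^]\<^bsub>F\<^esub> t"
  define H where "H = generate F ?S"
  have gen: "{a, b} \<subseteq> carrier F" "generate F {a, b} = carrier F"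
    using ab(1) by (simp_all add: free_basis_def)
  then have S: "?S \<subseteq> carrier F"
    by (intro cycles_basis_subset) auto
  obtain h :: "'a \<Rightarrow> int \<times> ('a \<times> bool) list \<Rightarrow> int \<times> ('a \<times> bool) list"
    where "h \<in> hom F (BijGroup UNIV)"
      and "\<And>s x. s \<in> ?S \<Longrightarrow> h s (0, x) = (0, prepend (s, True) x)"
    by (rule cycles_basis_action[OF ab d d']) blast
  then have basis: "free_basis (F\<lparr>carrier := H\<rparr>) ?S"
    unfolding H_def by (intro free_basis_generate[OF _ S])
  have H: "subgroup H F"
    unfolding H_def using S by (rule generate_is_subgroup)
  then have grp: "group (F\<lparr>carrier := H\<rparr>)"
    by (rule subgroup_imp_group)
  \<comment> \<open>\<open>?g\<close> was put among the generators, so it is primitive in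
    \<open>H\<close> as soon as \<open>?S\<close> is known to be a free basis of
    \<open>H\<close>.\<close>
  have "?g \<in> ?S"
    by (simp add: cycles_basis_def)
  then have "?g \<in> H"
    unfolding H_def by (rule generate.incl)
  with \<open>?g \<in> ?S\<close> have "primitive_in (F\<lparr>carrier := H\<rparr>) ?g"
    using grp basis group.free_basis_not_one[OF grp basis]
    by (auto simp: primitive_in_def free_group_def)
  moreover have index: "finite (rcosets\<^bsub>F\<^esub> H)" "card (rcosets\<^bsub>F\<^esub> H) \<le> d + d' - 2"
    using cycles_basis_index[OF gen d d'] by (simp_all add: H_def)
  ultimately have "d_prim ?g F \<le> enat (card (rcosets\<^bsub>F\<^esub> H))"
    unfolding d_prim_def finite_index_subgroup_def using H \<open>?g \<in> H\<close> by (intro Inf_lower) blast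
  also have "\<dots> \<le> enat (d + d' - 2)"
    using index(2) by simp
  finally show ?thesis .
qed

theorem theorem1p4:
  fixes F :: "('a, 'b) monoid_scheme"
    and a b :: 'a
    and n t d d' :: nat
  assumes "group F"
    and "free_basis F {a, b}" and "a \<noteq> b"
    and "n \<ge> 1" and "t \<ge> 1"
    and "d \<ge> 2" and "d' \<ge> 2"
    and "\<not> d dvd n" and "\<not> d' dvd t"
    and "d \<le> n" and "d' \<le> t"
  shows "d_simp (a [^]\<^bsub>F\<^esub> n \<otimes>\<^bsub>F\<^esub> b [^]\<^bsub>F\<^esub> t) F \<le> d_prim (a [^]\<^bsub>F\<^esub> n \<otimes>\<^bsub>F\<^esub> b [^]\<^bsub>F\<^esub> t) F
       \<and> d_prim (a [^]\<^bsub>F\<^esub> n \<otimes>\<^bsub>F\<^esub> b [^]\<^bsub>F\<^esub> t) F \<le> enat (d + d' - 2)"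
  using d_simp_le_d_prim[OF assms(1-3)] d_prim_le[OF assms(1-3)] assms by simp

end
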